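(* For every integer $a\geq 3$, $\mathrm{g}(T(a))=\mathrm{g}(S(a))+2=\frac{a}{5}(l_a+l_{a-2})+2$ and \[\mathrm{F}(T(a))=\max\{\mathrm{F}(S(a)),\,2l_a+1\}=\begin{cases}2l_a+1, & \text{if } a\in\{3,4,5\},\\ \left\lceil\frac{a-1}{2}\right\rceil l_a-1, & \text{if } a\geq 6.\end{cases}\]
   Context: $\mathbb{N}=\{0,1,2,\ldots\}$. The Lucas series $\{l_n\}_{n\in\mathbb{N}}$ is defined by $l_0=2$, $l_1=1$, $l_{n+2}=l_{n+1}+l_n$. For $a\in\mathbb{N}$, $S(a)$ is the submonoid of $(\mathbb{N},+)$ generated by $\{l_a\}\cup\{l_a+l_n\mid n\in\mathbb{N}\}$, and $T(a)$ is the submonoid of $(\mathbb{N},+)$ generated by $\{l_a+l_n\mid n\in\mathbb{N}\}$; both are numerical semigroups, i.e. have finite complement in $\mathbb{N}$. For a numerical semigroup $S$, the Frobenius number $\mathrm{F}(S)$ is the greatest integer not belonging to $S$ and the genus $\mathrm{g}(S)$ is the cardinality of $\mathbb{N}\setminus S$. *)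

theory Defs
  imports Complex_Main
begin

fun lucas :: "nat \<Rightarrow> nat" where
  "lucas 0 = 2"
| "lucas (Suc 0) = 1"
| "lucas (Suc (Suc n)) = lucas (Suc n) + lucas n"

definition is_submonoid :: "nat set \<Rightarrow> bool" where
  "is_submonoid M \<longleftrightarrow> 0 \<in> M \<and> (\<forall>x\<in>M. \<forall>y\<in>M. x + y \<in> M)"

definition submonoid_gen :: "nat set \<Rightarrow> nat set" where
  "submonoid_gen X = is_submonoid hull X"

definition S :: "nat \<Rightarrow> nat set" where
  "S a = submonoid_gen ({lucas a} \<union> {lucas a + lucas n | n. True})"

definition T :: "nat \<Rightarrow> nat set" where
  "T a = submonoid_gen {lucas a + lucas n | n. True}"

(* The greatest integer outside A, so that the value for A = UNIV is -1.
   Unspecified if the complement of A in the naturals is infinite. *)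
definition frobenius :: "nat set \<Rightarrow> int" where
  "frobenius A = (GREATEST z :: int. z \<notin> int ` A)"

(* card is 0 on infinite sets, so a positive genus entails a finite complement. *)
definition genus :: "nat set \<Rightarrow> nat" where
  "genus A = card (UNIV - A)"

end

(* Let L = l_a and let g(x) be the number of summands in the greedy expansion of x into Lucas
   numbers.  The function g is subadditive, and the residue r < L is first reached in S(a) by
   g(r) * L + r.  So the genus of S(a) is the sum of g(r) over r < L, which satisfies a
   Fibonacci-type recurrence, and its Frobenius number comes from r = L - 1, where g is maximal
   with value a div 2.  Finally T(a) is S(a) without the two elements L and 2 L + 1. *)
theory Submission
  imports Defs
begin

section \<open>Generated submonoids\<close>

lemma is_submonoid_submonoid_gen: "is_submonoid (submonoid_gen X)"
  unfolding submonoid_gen_def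
  by (rule hull_in) (auto simp: is_submonoid_def)

lemma submonoid_gen_zero: "0 \<in> submonoid_gen X"
  using is_submonoid_submonoid_gen by (simp add: is_submonoid_def)

lemma submonoid_gen_add:
  "x \<in> submonoid_gen X \<Longrightarrow> y \<in> submonoid_gen X \<Longrightarrow> x + y \<in> submonoid_gen X"
  using is_submonoid_submonoid_gen by (simp add: is_submonoid_def)

lemma submonoid_gen_base: "x \<in> X \<Longrightarrow> x \<in> submonoid_gen X"
  unfolding submonoid_gen_def by (rule hull_inc)

lemma submonoid_gen_subset: "X \<subseteq> M \<Longrightarrow> is_submonoid M \<Longrightarrow> submonoid_gen X \<subseteq> M"
  unfolding submonoid_gen_def by (rule hull_minimal)

lemma submonoid_gen_mult: "x \<in> submonoid_gen X \<Longrightarrow> k * x \<in> submonoid_gen X"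
  by (induction k) (simp_all add: submonoid_gen_zero submonoid_gen_add)

lemma submonoid_gen_induct [consumes 1, case_names zero add]:
  assumes "y \<in> submonoid_gen X"
    and "P 0"
    and step: "\<And>x y. x \<in> X \<Longrightarrow> y \<in> submonoid_gen X \<Longrightarrow> P y \<Longrightarrow> P (x + y)"
  shows "P y"
proof -
  \<comment> \<open>The \<open>x\<close> with \<open>P x\<close> need not be closed under addition,
    so minimality of the hull is applied to the \<open>x\<close> whose addition preserves
    \<open>P\<close>; then \<open>z = 0\<close> yields \<open>P y\<close>.\<close>
  let ?Q = "{x \<in> submonoid_gen X. \<forall>z \<in> submonoid_gen X. P z \<longrightarrow> P (x + z)}"
  have "is_submonoid ?Q"
    by (auto simp: is_submonoid_def add.assoc intro: submonoid_gen_zero submonoid_gen_add)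
  moreover have "X \<subseteq> ?Q"
    by (auto intro: submonoid_gen_base step)
  ultimately have "y \<in> ?Q"
    using submonoid_gen_subset assms(1) by blast
  then show ?thesis
    using submonoid_gen_zero \<open>P 0\<close> by fastforce
qed

lemma submonoid_gen_cases:
  assumes "y \<in> submonoid_gen X"
  obtains "y = 0" | x z where "x \<in> X" "z \<in> submonoid_gen X" "y = x + z"
proof -
  from assms have "y = 0 \<or> (\<exists>x\<in>X. \<exists>z\<in>submonoid_gen X. y = x + z)"
    by (induction rule: submonoid_gen_induct) auto
  then show thesis
    using that by blast
qed

section \<open>Greedy Lucas expansions\<close>

lemma lucas_pos: "0 < lucas n"
  by (induction n rule: lucas.induct) auto

lemma lucas_Suc_gt: "1 \<le> n \<Longrightarrow> lucas n < lucas (Suc n)"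
  by (cases n) (auto simp: lucas_pos)

lemma lucas_mono: "1 \<le> m \<Longrightarrow> m \<le> n \<Longrightarrow> lucas m \<le> lucas n"
proof (induction n)
  case (Suc n)
  then show ?case
    using lucas_Suc_gt[of n] by (cases "m = Suc n") auto
qed simp

lemma lucas_le: "2 \<le> n \<Longrightarrow> m \<le> n \<Longrightarrow> lucas m \<le> lucas n"
  using lucas_mono[of m n] lucas_mono[of 2 n] by (cases "m = 0") (auto simp: numeral_2_eq_2)

lemma lucas_gt_self: "n < lucas (Suc (Suc n))"
proof (induction n)
  case (Suc n)
  then show ?case
    using lucas_Suc_gt[of "Suc (Suc n)"] by linarith
qed simp

text \<open>For \<open>n = 2\<close> the bracketing index would be 1, yet the largest Lucas number
  up to 2 is \<open>lucas 0\<close>. From 3 on, the bracketing index gives the greedy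
  summand.\<close>

lemma lucas_bracket:
  assumes "3 \<le> n"
  obtains k where "2 \<le> k" "lucas k \<le> n" "n < lucas (Suc k)"
proof -
  define k where "k = (LEAST k. n < lucas (Suc k))"
  have ex: "n < lucas (Suc (Suc n))"
    by (rule lucas_gt_self)
  have upper: "n < lucas (Suc k)"
    unfolding k_def by (rule LeastI) (rule ex)
  have "2 \<le> k"
  proof (rule ccontr)
    assume "\<not> 2 \<le> k"
    then have "lucas (Suc k) \<le> 3"
      using lucas_le[of 2 "Suc k"] by (auto simp: less_2_cases_iff numeral_2_eq_2)
    then show False
      using upper assms by simp
  qed
  have "\<not> n < lucas (Suc (k - 1))"
    using not_less_Least[of "k - 1" "\<lambda>k. n < lucas (Suc k)"] \<open>2 \<le> k\<close> unfolding k_def by simp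
  with \<open>2 \<le> k\<close> upper show thesis
    by (intro that[of k]) auto
qed

text \<open>The summand is chosen by its value, not by its index, since
  \<open>lucas 0 > lucas 1\<close> makes the two orders disagree.\<close>

function lucas_digits :: "nat \<Rightarrow> nat" where
  "lucas_digits n =
    (if n = 0 then 0 else Suc (lucas_digits (n - Max (range lucas \<inter> {..n}))))"
  by auto
termination
proof (relation "measure id")
  fix n :: nat
  assume "n \<noteq> 0"
  then have "lucas 1 \<in> range lucas \<inter> {..n}"
    using rangeI[of lucas 1] by simp
  then have "Max (range lucas \<inter> {..n}) \<in> range lucas"
    using Max_in[of "range lucas \<inter> {..n}"] by blast
  then have "0 < Max (range lucas \<inter> {..n})"
    using lucas_pos by auto
  then show "(n - Max (range lucas \<inter> {..n}), n) \<in> measure id"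
    using \<open>n \<noteq> 0\<close> by simp
qed simp

declare lucas_digits.simps [simp del]

lemma lucas_digits_0 [simp]: "lucas_digits 0 = 0"
  by (simp add: lucas_digits.simps)

lemma lucas_digits_greedy:
  assumes "lucas i \<le> n" "\<And>j. lucas j \<le> n \<Longrightarrow> lucas j \<le> lucas i"
  shows "lucas_digits n = Suc (lucas_digits (n - lucas i))"
proof -
  have "Max (range lucas \<inter> {..n}) = lucas i"
    by (rule Max_eqI) (use assms in auto)
  then show ?thesis
    using assms(1) lucas_pos[of i] by (subst lucas_digits.simps) simp
qed

lemma lucas_digits_step:
  assumes "2 \<le> k" "lucas k \<le> n" "n < lucas (Suc k)"
  shows "lucas_digits n = Suc (lucas_digits (n - lucas k))"
proof (rule lucas_digits_greedy)
  fix j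
  assume "lucas j \<le> n"
  then have "\<not> Suc k \<le> j"
    using lucas_mono[of "Suc k" j] assms(3) by linarith
  then show "lucas j \<le> lucas k"
    using assms(1) by (intro lucas_le) auto
qed fact

text \<open>The sum stays below \<open>lucas (Suc (Suc k))\<close>, so the greedy choice is
  \<open>lucas (Suc k)\<close> with remainder \<open>x\<close>.\<close>

lemma lucas_digits_add:
  assumes "1 \<le> k" "x < lucas k"
  shows "lucas_digits (lucas (Suc k) + x) = Suc (lucas_digits x)"
  using lucas_digits_step[of "Suc k" "lucas (Suc k) + x"] assms by simp

lemma lucas_digits_1 [simp]: "lucas_digits (Suc 0) = 1"
proof -
  have "lucas j \<le> lucas 1" if "lucas j \<le> 1" for j
    using that by simp
  then show ?thesis
    using lucas_digits_greedy[of 1 1] by simp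
qed

lemma lucas_digits_2 [simp]: "lucas_digits 2 = 1"
proof -
  have "lucas j \<le> lucas 0" if "lucas j \<le> 2" for j
    using that by simp
  then show ?thesis
    using lucas_digits_greedy[of 0 2] by simp
qed

text \<open>Sums \<open>n + lucas i\<close> with \<open>n < 7\<close> and \<open>i \<le> 3\<close>
  are at most 10; this table settles them.\<close>

lemma lucas_digits_small:
  "lucas_digits 3 = 1" "lucas_digits 4 = 1" "lucas_digits 5 = 2" "lucas_digits 6 = 2"
  "lucas_digits 7 = 1" "lucas_digits 8 = 2" "lucas_digits 9 = 2" "lucas_digits 10 = 2"
proof -
  show "lucas_digits 3 = 1"
    using lucas_digits_step[of 2 3] by (simp add: numeral_eq_Suc)
  then show "lucas_digits 10 = 2"
    using lucas_digits_step[of 4 10] by (simp add: numeral_eq_Suc)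
  show "lucas_digits 4 = 1" "lucas_digits 5 = 2"
    using lucas_digits_step[of 3 4] lucas_digits_step[of 3 5]
    by (simp_all add: numeral_eq_Suc)
  show "lucas_digits 6 = 2"
    using lucas_digits_step[of 3 6] lucas_digits_2 by (simp add: numeral_eq_Suc)
  show "lucas_digits 7 = 1" "lucas_digits 8 = 2"
    using lucas_digits_step[of 4 7] lucas_digits_step[of 4 8]
    by (simp_all add: numeral_eq_Suc)
  show "lucas_digits 9 = 2"
    using lucas_digits_step[of 4 9] lucas_digits_2 by (simp add: numeral_eq_Suc)
qed

lemma lucas_digits_lucas: "lucas_digits (lucas n) = 1"
proof -
  consider "n = 0" | "n = 1" | k where "n = Suc k" "1 \<le> k"
    by (metis One_nat_def not0_implies_Suc not_less_eq_eq le_zero_eq)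
  then show ?thesis
  proof cases
    case 3
    then show ?thesis
      using lucas_digits_add[of k 0] lucas_pos[of k] by simp
  qed simp_all
qed

section \<open>Subadditivity of the greedy count\<close>

text \<open>When adding \<^term>\<open>lucas k\<close> overflows, it merges with the leading digit
  \<^term>\<open>lucas (k - 1)\<close> of \<^term>\<open>x\<close> into \<^term>\<open>lucas (k + 1)\<close>.\<close>

lemma lucas_digits_add_lucas:
  assumes "3 \<le> k" "x < lucas k"
  shows "lucas_digits (lucas k + x) = (if x < lucas (k - 1) then Suc (lucas_digits x)
           else lucas_digits x)"
proof -
  from assms obtain j where k: "k = Suc (Suc j)" "1 \<le> j"
    by (metis One_nat_def Suc_le_D Suc_le_mono numeral_3_eq_3)
  show ?thesis
  proof (cases "x < lucas (Suc j)")
    case True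
    then show ?thesis
      using lucas_digits_add[of "Suc j" x] k by simp
  next
    case False
    define y where "y = x - lucas (Suc j)"
    have x: "x = lucas (Suc j) + y" and y: "y < lucas j"
      using False assms(2) k by (auto simp: y_def)
    have "lucas j \<le> lucas k"
      using k by (intro lucas_mono) auto
    then have "lucas_digits (lucas (Suc k) + y) = Suc (lucas_digits y)"
      using y k by (intro lucas_digits_add) auto
    moreover have "lucas_digits x = Suc (lucas_digits y)"
      unfolding x using y k by (intro lucas_digits_add) auto
    moreover have "lucas k + x = lucas (Suc k) + y"
      using k x by simp
    ultimately show ?thesis
      using False k by (simp del: lucas.simps)
  qed
qed

lemma lucas_digits_add_lucas_small:
  assumes "n < 7" "i \<le> 3"
  shows "lucas_digits (n + lucas i) \<le> Suc (lucas_digits n)"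
proof -
  have "n \<in> {0, 1, 2, 3, 4, 5, 6}" "i \<in> {0, 1, 2, 3}"
    using assms by auto
  then show ?thesis
    using lucas_digits_small lucas_digits_2 by (auto simp: numeral_eq_Suc)
qed

text \<open>Outside the overflow case and a finite check, the leading summand \<open>lucas k\<close>
  of \<open>n\<close> is stripped. For \<open>i\<close> equal to \<open>k\<close> or
  \<open>k - 1\<close> the recurrence merges the two; a smaller summand goes to the remainder, where
  induction applies.\<close>

lemma lucas_digits_add_lucas_le: "lucas_digits (n + lucas i) \<le> Suc (lucas_digits n)"
proof (induction n arbitrary: i rule: less_induct)
  case (less n)
  have overflow: "lucas_digits (lucas j + x) \<le> Suc (lucas_digits x)"
    if "3 \<le> j" "x < lucas j" for j x
    using lucas_digits_add_lucas[OF that] by simp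
  consider "3 \<le> i" "n < lucas i" | "n < 7" "i \<le> 3" | "7 \<le> n" "i < 3 \<or> lucas i \<le> n"
  proof -
    have "7 \<le> lucas i" if "4 \<le> i"
      using lucas_mono[of 4 i] that by (simp add: numeral_eq_Suc)
    then consider "i \<le> 3" | "4 \<le> i" "7 \<le> lucas i"
      by linarith
    then show ?thesis
    proof cases
      case 1
      then consider "n < 7" | "7 \<le> n" "i < 3" | "7 \<le> n" "i = 3"
        by linarith
      then show ?thesis
        by cases (use that 1 in \<open>auto simp: numeral_3_eq_3\<close>)
    next
      case 2
      then show ?thesis
        using that by linarith
    qed
  qed
  then show ?case
  proof cases
    case 1
    then show ?thesis
      using overflow by (simp add: add.commute)
  next
    case 2
    then show ?thesis
      by (rule lucas_digits_add_lucas_small)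
  next
    case 3
    obtain k where k: "2 \<le> k" "lucas k \<le> n" "n < lucas (Suc k)"
      using lucas_bracket[of n] 3 by auto
    \<comment> \<open>Since \<open>7 = lucas 4\<close>, the index \<open>j = k - 2\<close> is at
      least 2, which is where \<open>lucas i \<le> lucas j\<close> holds for all
      \<open>i \<le> j\<close>; it fails at \<open>j = 1\<close>, \<open>i = 0\<close>.\<close>
    have "\<not> k \<le> 3"
      using lucas_mono[of "Suc k" 4] k 3 by (auto simp: numeral_eq_Suc)
    then obtain j where j: "k = Suc (Suc j)" "2 \<le> j"
      by (metis Suc_le_D Suc_le_mono not_less_eq_eq numeral_2_eq_2 numeral_3_eq_3)
    have "\<not> Suc k \<le> i"
      using lucas_mono[of "Suc k" i] k 3 \<open>\<not> k \<le> 3\<close> by auto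
    define m where "m = n - lucas k"
    have n: "n = lucas k + m" and m: "m < lucas (Suc j)" "m < n"
      using k j lucas_pos[of k] by (auto simp: m_def)
    have dn: "lucas_digits n = Suc (lucas_digits m)"
      unfolding n using m j lucas_digits_add[of "Suc j" m] by simp
    consider "i = k" | "i = Suc j" | "i \<le> j"
      using \<open>\<not> Suc k \<le> i\<close> j by linarith
    then show ?thesis
    proof cases
      case 1
      \<comment> \<open>The doubled summand is rewritten by
        \<open>2 * lucas k = lucas (Suc k) + lucas j\<close>, and \<open>lucas j\<close> joins the
        remainder.\<close>
      have "lucas_digits (lucas (Suc k) + (m + lucas j)) = Suc (lucas_digits (m + lucas j))"
        using j m by (intro lucas_digits_add) auto
      moreover have "n + lucas i = lucas (Suc k) + (m + lucas j)"
        using n 1 j by simp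
      ultimately show ?thesis
        using less.IH[of m j] m dn by simp
    next
      case 2
      have "lucas_digits (lucas (Suc k) + m) = Suc (lucas_digits m)"
        using j m by (intro lucas_digits_add) auto
      moreover have "n + lucas i = lucas (Suc k) + m"
        using n 2 j by simp
      ultimately show ?thesis
        using dn by simp
    next
      case 3
      \<comment> \<open>The new remainder may reach \<open>lucas (Suc j)\<close> and so be too large
        for a greedy remainder, but below \<open>lucas k\<close> the overflow bound still allows
        reattaching \<open>lucas k\<close> at the cost of one.\<close>
      then have "m + lucas i < lucas k"
        using lucas_le[of j i] m j by simp
      then have "lucas_digits (lucas k + (m + lucas i)) \<le> Suc (lucas_digits (m + lucas i))"
        using j by (intro overflow) auto
      also have "\<dots> \<le> Suc (Suc (lucas_digits m))"
        using less.IH[of m i] m by simp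
      finally show ?thesis
        using dn n by (simp add: add.assoc)
    qed
  qed
qed

lemma lucas_digits_expand:
  assumes "0 < n"
  obtains i where "lucas i \<le> n" "lucas_digits n = Suc (lucas_digits (n - lucas i))"
proof (cases "3 \<le> n")
  case True
  then show thesis
    using lucas_bracket[of n] lucas_digits_step that by metis
next
  case False
  then consider "n = 1" | "n = 2"
    using assms by linarith
  then show thesis
    by cases (use that[of 1] that[of 0] in auto)
qed

text \<open>The greedy summands of \<open>n\<close> are added to \<open>m\<close> one at a time,
  each raising the count by at most one.\<close>

lemma lucas_digits_subadd: "lucas_digits (m + n) \<le> lucas_digits m + lucas_digits n"
proof (induction n arbitrary: m rule: less_induct)
  case (less n)
  show ?case
  proof (cases "n = 0")
    case False
    then obtain i where i: "lucas i \<le> n" "lucas_digits n = Suc (lucas_digits (n - lucas i))"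
      using lucas_digits_expand[of n] by auto
    have "lucas_digits (m + n) = lucas_digits (m + (n - lucas i) + lucas i)"
      using i(1) by simp
    also have "\<dots> \<le> Suc (lucas_digits (m + (n - lucas i)))"
      by (rule lucas_digits_add_lucas_le)
    also have "\<dots> \<le> lucas_digits m + lucas_digits n"
      using less.IH[of "n - lucas i" m] lucas_pos[of i] i False by simp
    finally show ?thesis .
  qed simp
qed

section \<open>Maximum and sum of the greedy count below a Lucas number\<close>

lemma lucas_digits_less_lucas: "1 \<le> k \<Longrightarrow> x < lucas k \<Longrightarrow> lucas_digits x \<le> k div 2"
proof (induction k arbitrary: x rule: lucas.induct)
  case (3 k)
  show ?case
  proof (cases "x < lucas (Suc k)")
    case True
    then have "lucas_digits x \<le> Suc k div 2"
      using 3 by simp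
    then show ?thesis
      by linarith
  next
    case False
    show ?thesis
    proof (cases "k = 0")
      case True
      then have "x = 1 \<or> x = 2"
        using False 3 by auto
      then show ?thesis
        by auto
    next
      case False
      \<comment> \<open>After the summand \<open>lucas (Suc k)\<close> the remainder is below
        \<open>lucas k\<close>: one summand lowers the index by two, whence the halving.\<close>
      define y where "y = x - lucas (Suc k)"
      have "x = lucas (Suc k) + y" "y < lucas k"
        using \<open>\<not> x < lucas (Suc k)\<close> 3 by (auto simp: y_def)
      then show ?thesis
        using 3(2)[of y] lucas_digits_add[of k y] False by simp
    qed
  qed
qed auto

text \<open>Since \<open>lucas (k + 2) - 1 = lucas (k + 1) + (lucas k - 1)\<close>, every step of
  two in the index uses one summand, so the bound \<open>k div 2\<close> is attained.\<close>

lemma lucas_digits_lucas_minus_1: "1 \<le> k \<Longrightarrow> lucas_digits (lucas k - 1) = k div 2"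
proof (induction k rule: lucas.induct)
  case (3 k)
  show ?case
  proof (cases "k = 0")
    case False
    have "lucas (Suc (Suc k)) - 1 = lucas (Suc k) + (lucas k - 1)"
      using lucas_pos[of k] by simp
    then show ?thesis
      using 3 False lucas_digits_add[of k "lucas k - 1"] lucas_pos[of k] by simp
  qed (use lucas_digits_2 in \<open>simp add: numeral_2_eq_2\<close>)
qed auto

text \<open>Cutting the range at \<open>lucas (n + 3)\<close> gives
  \<open>s (n + 2) = s (n + 1) + s n + lucas (n + 2)\<close> for the sums \<open>s\<close>, because
  each count in the upper piece is one more than in its shift. The factor 5 and the shift by 2 avoid
  division and truncated subtraction.\<close>

lemma sum_lucas_digits:
  "5 * (\<Sum>r<lucas (n + 2). lucas_digits r) = (n + 2) * (lucas (n + 2) + lucas n)"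
proof (induction n rule: lucas.induct)
  case 1
  then show ?case
    using lucas_digits_2 by (simp add: numeral_eq_Suc)
next
  case 2
  then show ?case
    using lucas_digits_2 lucas_digits_small(1) by (simp add: numeral_eq_Suc)
next
  case (3 n)
  have split: "sum f {..<b + c} = sum f {..<b} + (\<Sum>r<c. f (b + r))" for f :: "nat \<Rightarrow> nat" and b c
    by (induction c) (simp_all add: add.assoc)
  have "(\<Sum>r<lucas (n + 4). lucas_digits r) = (\<Sum>r<lucas (n + 3). lucas_digits r)
      + (\<Sum>r<lucas (n + 2). lucas_digits (lucas (n + 3) + r))"
    using split[of lucas_digits "lucas (n + 3)" "lucas (n + 2)"] by (simp add: numeral_eq_Suc)
  also have "(\<Sum>r<lucas (n + 2). lucas_digits (lucas (n + 3) + r))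
      = (\<Sum>r<lucas (n + 2). Suc (lucas_digits r))"
    using lucas_digits_add[of "n + 2"] by (intro sum.cong) (auto simp: numeral_eq_Suc)
  finally have "5 * (\<Sum>r<lucas (n + 4). lucas_digits r) = 5 * (\<Sum>r<lucas (n + 3). lucas_digits r)
      + 5 * (\<Sum>r<lucas (n + 2). lucas_digits r) + 5 * lucas (n + 2)"
    by (simp add: sum_Suc)
  then show ?case
    using 3 by (simp add: numeral_eq_Suc algebra_simps)
qed

section \<open>The semigroups\<close>

lemma lucas_in_S: "lucas a \<in> S a" and lucas_add_in_S: "lucas a + lucas n \<in> S a"
  unfolding S_def by (auto intro: submonoid_gen_base)

lemma S_closed: "x \<in> S a \<Longrightarrow> y \<in> S a \<Longrightarrow> x + y \<in> S a"
  unfolding S_def by (rule submonoid_gen_add)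

text \<open>Each greedy summand \<open>lucas i\<close> of \<open>r\<close> is paired with one
  \<open>lucas a\<close> to form a generator.\<close>

lemma lucas_digits_mult_add_in_S: "lucas_digits r * lucas a + r \<in> S a"
proof (induction r rule: less_induct)
  case (less r)
  show ?case
  proof (cases "r = 0")
    case True
    then show ?thesis
      by (simp add: S_def submonoid_gen_zero)
  next
    case False
    then obtain i where i: "lucas i \<le> r" "lucas_digits r = Suc (lucas_digits (r - lucas i))"
      using lucas_digits_expand[of r] by auto
    have "lucas_digits (r - lucas i) * lucas a + (r - lucas i) \<in> S a"
      using lucas_pos[of i] False by (intro less.IH) auto
    from S_closed[OF lucas_add_in_S[of a i] this] show ?thesis
      using i by (simp add: algebra_simps)
  qed
qed

lemma is_submonoid_lucas_digits:
  assumes "3 \<le> a"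
  shows "is_submonoid {x. lucas_digits (x mod lucas a) \<le> x div lucas a}"
  unfolding is_submonoid_def
proof (intro conjI ballI CollectI)
  fix x y
  assume "x \<in> {x. lucas_digits (x mod lucas a) \<le> x div lucas a}"
    and "y \<in> {x. lucas_digits (x mod lucas a) \<le> x div lucas a}"
  then have xy: "lucas_digits (x mod lucas a) \<le> x div lucas a"
      "lucas_digits (y mod lucas a) \<le> y div lucas a"
    by auto
  define r where "r = x mod lucas a + y mod lucas a"
  have "lucas_digits r \<le> x div lucas a + y div lucas a"
    unfolding r_def using lucas_digits_subadd xy by (meson add_mono le_trans)
  \<comment> \<open>Two residues sum to less than \<open>2 * lucas a\<close>, so there is at most
    one carry, and removing that \<open>lucas a\<close> does not increase the count.\<close>
  moreover have "lucas_digits (r mod lucas a) \<le> lucas_digits r + r div lucas a"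
  proof (cases "r < lucas a")
    case False
    define s where "s = r - lucas a"
    have "x mod lucas a < lucas a" "y mod lucas a < lucas a"
      by (intro mod_less_divisor lucas_pos)+
    then have s: "r = lucas a + s" "s < lucas a"
      using False unfolding s_def r_def by linarith+
    then have "lucas_digits s \<le> lucas_digits r"
      using lucas_digits_add_lucas[OF assms s(2)] by simp
    then show ?thesis
      using s by simp
  qed simp
  moreover have "(x + y) mod lucas a = r mod lucas a"
    by (simp add: r_def mod_add_eq)
  moreover have "(x + y) div lucas a = x div lucas a + y div lucas a + r div lucas a"
    unfolding r_def by (rule div_add1_eq)
  ultimately show "lucas_digits ((x + y) mod lucas a) \<le> (x + y) div lucas a"
    by simp
qed simp

lemma S_eq:
  assumes "3 \<le> a"
  shows "S a = {x. lucas_digits (x mod lucas a) \<le> x div lucas a}" (is "_ = ?M")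
proof
  have add: "x + y \<in> ?M" if "x \<in> ?M" "y \<in> ?M" for x y
    using is_submonoid_lucas_digits[OF assms] that unfolding is_submonoid_def by blast
  have base: "lucas a \<in> ?M"
    using lucas_pos[of a] by simp
  have small: "lucas a + lucas n \<in> ?M" if "n < a" for n
  proof -
    have "lucas n \<le> lucas (a - 1)"
      using that assms by (intro lucas_le) auto
    also have "lucas (a - 1) < lucas a"
      using lucas_Suc_gt[of "a - 1"] assms by simp
    finally show ?thesis
      using lucas_pos[of a] by (simp add: lucas_digits_lucas)
  qed
  \<comment> \<open>From index \<open>a\<close> on, membership follows from the recurrence and
    closure, starting with \<open>lucas a\<close> and
    \<open>lucas a + lucas (a - 1)\<close>.\<close>
  have large: "lucas (a + d) \<in> ?M" for d
  proof (induction d rule: lucas.induct)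
    case 2
    have "lucas (a + 1) = lucas a + lucas (a - 1)"
      using assms by (cases a rule: lucas.cases) auto
    then show ?case
      using small[of "a - 1"] assms by simp
  next
    case (3 d)
    then show ?case
      using add[of "lucas (a + Suc d)" "lucas (a + d)"] by simp
  qed (use base in simp)
  have "lucas a + lucas n \<in> ?M" for n
    using small[of n] add[OF base large[of "n - a"]] by (cases "n < a") auto
  then show "S a \<subseteq> ?M"
    unfolding S_def using is_submonoid_lucas_digits[OF assms] base
    by (intro submonoid_gen_subset) auto
next
  show "?M \<subseteq> S a"
  proof
    fix x
    assume "x \<in> ?M"
    \<comment> \<open>The surplus \<open>d\<close> counts the copies of the generator
      \<open>lucas a\<close> on top of the element built from the greedy expansion of the
      residue.\<close>
    then obtain d where d: "x div lucas a = lucas_digits (x mod lucas a) + d"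
      using le_iff_add by auto
    have "d * lucas a \<in> S a"
      using lucas_in_S unfolding S_def by (rule submonoid_gen_mult)
    from S_closed[OF this lucas_digits_mult_add_in_S[of "x mod lucas a" a]]
    have "x div lucas a * lucas a + x mod lucas a \<in> S a"
      by (simp add: d algebra_simps)
    then show "x \<in> S a"
      by simp
  qed
qed

section \<open>Gaps and genus of \<open>S a\<close>\<close>

lemma compl_S_bij:
  assumes "3 \<le> a"
  shows "bij_betw (\<lambda>(r, q). q * lucas a + r) (SIGMA r:{..<lucas a}. {..<lucas_digits r})
           (UNIV - S a)"
  \<comment> \<open>The gaps with residue \<open>r\<close> are those with quotient
    \<open>q < lucas_digits r\<close>; division with remainder inverts the map.\<close>
  by (rule bij_betw_byWitness[where f' = "\<lambda>x. (x mod lucas a, x div lucas a)"])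
    (auto simp: S_eq[OF assms] lucas_pos)

lemma finite_compl_S: "3 \<le> a \<Longrightarrow> finite (UNIV - S a)"
  using bij_betw_finite[OF compl_S_bij] by auto

lemma genus_S:
  assumes "3 \<le> a"
  shows "genus (S a) = (\<Sum>r<lucas a. lucas_digits r)"
  using bij_betw_same_card[OF compl_S_bij[OF assms]] by (simp add: genus_def)

section \<open>Comparison of \<open>T a\<close> with \<open>S a\<close>\<close>

lemma lucas_neq_Suc_lucas:
  assumes "3 \<le> a"
  shows "lucas n \<noteq> Suc (lucas a)"
proof (cases "n \<le> a")
  case True
  then show ?thesis
    using lucas_le[of a n] assms by simp
next
  case False
  \<comment> \<open>The Lucas number following \<open>lucas a\<close> exceeds it by at least
    3.\<close>
  then have "lucas (Suc a) \<le> lucas n"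
    by (intro lucas_mono) auto
  moreover have "lucas (Suc a) = lucas a + lucas (a - 1)"
    using assms by (cases a rule: lucas.cases) auto
  moreover have "3 \<le> lucas (a - 1)"
    using lucas_mono[of 2 "a - 1"] assms by (simp add: numeral_eq_Suc)
  ultimately show ?thesis
    by simp
qed

lemma T_closed: "x \<in> T a \<Longrightarrow> y \<in> T a \<Longrightarrow> x + y \<in> T a"
  unfolding T_def by (rule submonoid_gen_add)

lemma T_zero: "0 \<in> T a"
  unfolding T_def by (rule submonoid_gen_zero)

lemma lucas_add_in_T: "lucas a + lucas n \<in> T a"
  unfolding T_def by (auto intro: submonoid_gen_base)

lemma T_cases:
  assumes "y \<in> T a"
  obtains "y = 0" | n z where "z \<in> T a" "y = lucas a + lucas n + z"
  using assms unfolding T_def by (cases rule: submonoid_gen_cases) auto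

text \<open>The recurrence splits \<open>lucas n\<close> between two generators for
  \<open>n \<ge> 2\<close>, and \<open>lucas 0 = 1 + 1\<close>. But \<open>lucas 1\<close> is no sum
  of two Lucas numbers, whence the exceptional element \<open>2 * lucas a + 1\<close>.\<close>

lemma double_add_lucas_in_T:
  assumes "n \<noteq> 1"
  shows "2 * lucas a + lucas n \<in> T a"
  using assms
proof (cases n rule: lucas.cases)
  case 1
  then show ?thesis
    using T_closed[OF lucas_add_in_T[of a 1] lucas_add_in_T[of a 1]] by (simp add: mult_2)
next
  case (3 k)
  then show ?thesis
    using T_closed[OF lucas_add_in_T[of a "Suc k"] lucas_add_in_T[of a k]]
    by (simp add: mult_2 mult_2_right ac_simps)
qed simp

text \<open>A third generator repairs the exception: \<open>3 * lucas a + 2\<close> is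
  \<open>2 * lucas a\<close> plus \<open>lucas a + lucas 0\<close>.\<close>

lemma triple_Suc_add_lucas_in_T: "3 * lucas a + 1 + lucas n \<in> T a"
proof (cases "n = 1")
  case True
  then show ?thesis
    using T_closed[OF lucas_add_in_T[of a a] lucas_add_in_T[of a 0]]
    by (simp add: numeral_3_eq_3 add.assoc)
next
  case False
  then show ?thesis
    using T_closed[OF double_add_lucas_in_T[of n a] lucas_add_in_T[of a 1]] by simp
qed

text \<open>A generator \<open>lucas a + lucas n\<close> of \<open>y\<close> with
  \<open>n \<noteq> 1\<close> absorbs the extra \<open>lucas a\<close>. If \<open>n = 1\<close>, a
  further generator is used; what remains is \<open>y = 0\<close> and
  \<open>y = lucas a + 1\<close>, the sources of the two exceptions.\<close>

lemma lucas_add_T: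
  assumes "y \<in> T a"
  shows "lucas a + y \<in> T a \<union> {lucas a, 2 * lucas a + 1}"
  using assms
proof (cases rule: T_cases)
  case (2 n z)
  show ?thesis
  proof (cases "n = 1")
    case False
    then show ?thesis
      using T_closed[OF double_add_lucas_in_T[of n a] 2(1)] 2(2) by (simp add: mult_2 add.assoc)
  next
    case True
    from 2(1) show ?thesis
    proof (cases rule: T_cases)
      case 1
      then show ?thesis
        using 2 True by simp
    next
      case (2 m w)
      then show ?thesis
        using T_closed[OF triple_Suc_add_lucas_in_T[of a m] 2(1)] \<open>y = lucas a + lucas n + z\<close> True
        by (simp add: numeral_3_eq_3 ac_simps)
    qed
  qed
qed simp

text \<open>The right-hand side is stable under adding any single generator of \<open>S a\<close>,
  so peeling off generators one by one suffices.\<close>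

lemma S_eq_T: "S a = T a \<union> {lucas a, 2 * lucas a + 1}"
proof
  show "S a \<subseteq> T a \<union> {lucas a, 2 * lucas a + 1}"
  proof
    fix y
    assume "y \<in> S a"
    then show "y \<in> T a \<union> {lucas a, 2 * lucas a + 1}"
      unfolding S_def
    proof (induction rule: submonoid_gen_induct)
      case zero
      then show ?case
        by (simp add: T_zero)
    next
      case (add x y)
      have double: "2 * lucas a \<in> T a"
        using lucas_add_in_T[of a a] by (simp add: mult_2)
      have y: "y \<in> T a \<or> y = lucas a \<or> y = 2 * lucas a + 1"
        using add by auto
      consider "x = lucas a" | n where "x = lucas a + lucas n"
        using add by auto
      then show ?case
      proof cases
        case 1
        have "lucas a + (2 * lucas a + 1) \<in> T a"
          using T_closed[OF double lucas_add_in_T[of a 1]] by (simp add: algebra_simps)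
        with y 1 double lucas_add_T show ?thesis
          by (auto simp: mult_2)
      next
        case 2
        have "lucas a + lucas n + lucas a \<in> T a \<union> {2 * lucas a + 1}"
          using double_add_lucas_in_T[of n a] by (cases "n = 1") (auto simp: mult_2 mult_2_right ac_simps)
        moreover have "lucas a + lucas n + (2 * lucas a + 1) \<in> T a"
          using triple_Suc_add_lucas_in_T[of a n] by (simp add: algebra_simps)
        ultimately show ?thesis
          using y 2 T_closed[OF lucas_add_in_T[of a n]] by auto
      qed
    qed
  qed
next
  have "T a \<subseteq> S a"
    unfolding T_def S_def
    by (rule submonoid_gen_subset) (auto intro: submonoid_gen_base is_submonoid_submonoid_gen)
  moreover have "2 * lucas a + 1 \<in> S a"
    using S_closed[OF lucas_in_S lucas_add_in_S[of a 1]] by (simp add: mult_2)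
  ultimately show "T a \<union> {lucas a, 2 * lucas a + 1} \<subseteq> S a"
    using lucas_in_S by blast
qed

lemma lucas_notin_T: "lucas a \<notin> T a"
proof
  assume "lucas a \<in> T a"
  then show False
    by (cases rule: T_cases) (use lucas_pos in \<open>auto simp: less_imp_neq[THEN not_sym]\<close>)
qed

text \<open>A single generator would force \<open>lucas n = lucas a + 1\<close>, while two already
  sum to at least \<open>2 * lucas a + 2\<close>.\<close>

lemma double_lucas_Suc_notin_T:
  assumes "3 \<le> a"
  shows "2 * lucas a + 1 \<notin> T a"
proof
  assume "2 * lucas a + 1 \<in> T a"
  then show False
  proof (cases rule: T_cases)
    case (2 n z)
    then have sum: "lucas n + z = Suc (lucas a)"
      by simp
    from 2(1) show False
    proof (cases rule: T_cases)
      case 1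
      then show ?thesis
        using sum lucas_neq_Suc_lucas[OF assms, of n] by simp
    next
      case (2 m w)
      then show ?thesis
        using sum lucas_pos[of n] lucas_pos[of m] by simp
    qed
  qed simp
qed

lemma compl_T:
  assumes "3 \<le> a"
  shows "UNIV - T a = insert (lucas a) (insert (2 * lucas a + 1) (UNIV - S a))"
  using lucas_notin_T double_lucas_Suc_notin_T[OF assms] by (auto simp: S_eq_T)

lemma genus_T:
  assumes "3 \<le> a"
  shows "genus (T a) = genus (S a) + 2"
  unfolding genus_def compl_T[OF assms] using finite_compl_S[OF assms]
  by (simp add: S_eq_T)

section \<open>Frobenius numbers\<close>

lemma frobenius_eqI:
  assumes "f \<notin> A" "\<And>x. f < x \<Longrightarrow> x \<in> A"
  shows "frobenius A = int f"
  unfolding frobenius_def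
proof (rule Greatest_equality)
  fix z
  assume z: "z \<notin> int ` A"
  show "z \<le> int f"
  proof (rule ccontr)
    assume "\<not> z \<le> int f"
    then have "nat z \<in> A" "z = int (nat z)"
      using assms(2)[of "nat z"] by auto
    then show False
      using z by blast
  qed
qed (use assms(1) in auto)

text \<open>The residue \<open>lucas a - 1\<close> attains the maximal count \<open>a div 2\<close>,
  so quotient \<open>a div 2 - 1\<close> is too small for it, while quotient \<open>a div 2\<close>
  suffices for every residue.\<close>

lemma
  assumes "3 \<le> a"
  shows S_gap: "a div 2 * lucas a - 1 \<notin> S a"
    and S_above: "a div 2 * lucas a \<le> x \<Longrightarrow> x \<in> S a"
proof -
  obtain q where q: "a div 2 = Suc q"
    using assms by (cases "a div 2") auto
  have "a div 2 * lucas a - 1 = (lucas a - 1) + q * lucas a"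
    using q lucas_pos[of a] by simp
  moreover have "((lucas a - 1) + q * lucas a) mod lucas a = lucas a - 1"
    "((lucas a - 1) + q * lucas a) div lucas a = q"
    using lucas_pos[of a] by (simp_all only: mod_mult_self1 div_mult_self1) simp_all
  ultimately show "a div 2 * lucas a - 1 \<notin> S a"
    using lucas_digits_lucas_minus_1[of a] assms q by (simp add: S_eq)
  assume "a div 2 * lucas a \<le> x"
  then have "a div 2 \<le> x div lucas a"
    using lucas_pos[of a] by (simp add: less_eq_div_iff_mult_less_eq)
  moreover have "lucas_digits (x mod lucas a) \<le> a div 2"
    using assms lucas_pos[of a] by (intro lucas_digits_less_lucas) auto
  ultimately show "x \<in> S a"
    using assms by (simp add: S_eq)
qed

lemma frobenius_S: "3 \<le> a \<Longrightarrow> frobenius (S a) = int (a div 2 * lucas a - 1)"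
  by (rule frobenius_eqI) (auto simp: S_gap[unfolded One_nat_def] intro: S_above)

text \<open>The gaps of \<open>T a\<close> are those of \<open>S a\<close> together with
  \<open>lucas a\<close> and \<open>2 * lucas a + 1\<close>, and only the larger of these two can
  matter.\<close>

lemma frobenius_T:
  assumes "3 \<le> a"
  shows "frobenius (T a) = int (max (a div 2 * lucas a - 1) (2 * lucas a + 1))"
proof (rule frobenius_eqI)
  show "max (a div 2 * lucas a - 1) (2 * lucas a + 1) \<notin> T a"
    using S_gap[OF assms] double_lucas_Suc_notin_T[OF assms] by (auto simp: S_eq_T max_def)
  fix x
  assume "max (a div 2 * lucas a - 1) (2 * lucas a + 1) < x"
  then show "x \<in> T a"
    using S_above[OF assms, of x] by (auto simp: S_eq_T)
qed

lemma ceiling_half: "\<lceil>(real a - 1) / 2\<rceil> = int (a div 2)"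
proof (cases "even a")
  case True
  then obtain b where "a = 2 * b" ..
  then show ?thesis
    by (intro ceiling_unique) auto
next
  case False
  then obtain b where "a = 2 * b + 1"
    by (elim oddE)
  then show ?thesis
    by simp
qed

theorem corollary7p6:
  fixes a :: nat
  assumes "a \<ge> 3"
  shows "genus (T a) = genus (S a) + 2
       \<and> real (genus (S a) + 2) = real a / 5 * real (lucas a + lucas (a - 2)) + 2
       \<and> frobenius (T a) = max (frobenius (S a)) (2 * int (lucas a) + 1)
       \<and> max (frobenius (S a)) (2 * int (lucas a) + 1) =
           (if a \<in> {3, 4, 5} then 2 * int (lucas a) + 1
            else \<lceil>(real a - 1) / 2\<rceil> * int (lucas a) - 1)"
proof (intro conjI)
  show "genus (T a) = genus (S a) + 2"
    by (rule genus_T) fact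
  have "a - 2 + 2 = a"
    using assms by simp
  then have "5 * genus (S a) = a * (lucas a + lucas (a - 2))"
    using sum_lucas_digits[of "a - 2"] genus_S[OF assms] by metis
  then have "5 * real (genus (S a)) = real a * real (lucas a + lucas (a - 2))"
    by (metis of_nat_mult of_nat_numeral)
  then show "real (genus (S a) + 2) = real a / 5 * real (lucas a + lucas (a - 2)) + 2"
    by simp
  show "frobenius (T a) = max (frobenius (S a)) (2 * int (lucas a) + 1)"
    using assms by (simp add: frobenius_S frobenius_T)
  have "1 \<le> a div 2 * lucas a"
    using assms lucas_pos[of a] by (simp add: Suc_le_eq)
  then have F: "frobenius (S a) = int (a div 2) * int (lucas a) - 1"
    using frobenius_S[OF assms] by (simp add: of_nat_diff)
  show "max (frobenius (S a)) (2 * int (lucas a) + 1) =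
           (if a \<in> {3, 4, 5} then 2 * int (lucas a) + 1
            else \<lceil>(real a - 1) / 2\<rceil> * int (lucas a) - 1)"
  proof (cases "a \<in> {3, 4, 5}")
    case True
    \<comment> \<open>Here \<open>a div 2 \<le> 2\<close>, so the Frobenius number of
      \<open>S a\<close> lies below \<open>2 * lucas a\<close>.\<close>
    then show ?thesis
      unfolding F by auto
  next
    case False
    then have "3 \<le> a div 2"
      using assms by auto
    then have "3 * int (lucas a) \<le> int (a div 2) * int (lucas a)"
      by (intro mult_right_mono) auto
    \<comment> \<open>This turns \<open>3 * lucas a - 1\<close> into an upper bound of
      \<open>2 * lucas a + 1\<close>.\<close>
    moreover have "2 \<le> lucas a"
      using lucas_le[of a 0] assms by simp
    ultimately have "2 * int (lucas a) + 1 \<le> int (a div 2) * int (lucas a) - 1"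
      by linarith
    then show ?thesis
      unfolding F ceiling_half using False by simp
  qed
qed

end
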